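(* Let $((X_i)_{i\in N},(C_i)_{i\in N})$ be a game in choice form such that for each $x\in X$ there exists $i\in N$ with $C_i(x_{-i})\neq\emptyset$. Assume that, for each $i\in N$, the following conditions are fulfilled: (a) $X_i$ is a nonempty, convex and compact set in a Banach space $E_i$; (b) $C_i$ is nonempty and open (in $X$); (c) the set $W_i=\{x_{-i}\in X_{-i}: C_i(x_{-i})\neq\emptyset\}$ is nonempty and open (in $X_{-i}$); (d) there exists a lower semicontinuous correspondence $S_i:W_i\to 2^{X_i}$ with closed convex values such that $C_i(x_{-i})\cap S_i(x_{-i})\neq\emptyset$ for each $x_{-i}\in W_i$; (e) $C_i(x_{-i})$ is convex or empty for each $x_{-i}\in X_{-i}$. Then the game admits an equilibrium in choice.
   Context: $N=\{1,\dots,n\}$ is a finite set of players, $X=\prod_{i\in N}X_i$, $X_{-i}=\prod_{j\neq i}X_j$ (product topologies), $x_{-i}=(x_1,\dots,x_{i-1},x_{i+1},\dots,x_n)$, and $x=(x_{-i},x_i)$. A game in choice form is a double family $((X_i)_{i\in N},(C_i)_{i\in N})$, where the $X_i$ are nonempty sets and $(C_i)_{i\in N}$ is a collection of nonempty subsets of $X$. The upper section of $C_i$ through $x_{-i}$ is $C_i(x_{-i})=\{y_i\in X_i:(x_{-i},y_i)\in C_i\}$. An element $x^*\in X$ is an equilibrium in choice if $x_i^*\in C_i(x_{-i}^* )$ for every $i\in N$ for which $C_i(x_{-i}^* )\neq\emptyset$. A correspondence $T:Z\to 2^Y$ between topological spaces ($2^Y$ is the family of all subsets of $Y$) is lower semicontinuous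 if for each $z\in Z$ and each open $V\subset Y$ with $T(z)\cap V\neq\emptyset$ there is an open neighborhood $U$ of $z$ such that $T(z')\cap V\neq\emptyset$ for all $z'\in U$. *)

theory Defs
  imports "HOL-Analysis.Analysis" "HOL-Algebra.Module"
begin

section \<open>Banach spaces with explicit carrier\<close>

text \<open>
  The players' strategy sets live in Banach spaces that may differ from player to player, so a
  Banach space has to be a value rather than an instance of the type class \<open>banach\<close>. It is a
  module over the ring of real numbers, in the sense of HOL-Algebra, equipped with a norm that is
  complete on the carrier. The multiplication and unit fields which the record inherits from
  \<open>ring\<close> are unused. A finite family of spaces can always be given one common element type.
\<close>

definition real_ring :: "real ring" where
  "real_ring = \<lparr>carrier = UNIV, monoid.mult = (*), one = 1, ring.zero = 0, add = (+)\<rparr>"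

lemma cring_real_ring: "cring real_ring"
proof (rule cringI)
  show "abelian_group real_ring"
  proof (rule abelian_groupI)
    fix x assume "x \<in> carrier real_ring"
    show "\<exists>y\<in>carrier real_ring. y \<oplus>\<^bsub>real_ring\<^esub> x = \<zero>\<^bsub>real_ring\<^esub>"
      by (rule bexI[of _ "- x"]) (auto simp: real_ring_def)
  qed (auto simp: real_ring_def)
  show "Group.comm_monoid real_ring"
    by (rule comm_monoidI) (auto simp: real_ring_def)
qed (auto simp: real_ring_def algebra_simps)

record 'e nspace = "(real, 'e) module" +
  nrm :: "'e \<Rightarrow> real"

text \<open>
  The locale \<open>Metric_space\<close> wants nonnegativity and symmetry also outside the carrier, hence the
  default value.
\<close>

definition ndist :: "'e nspace \<Rightarrow> 'e \<Rightarrow> 'e \<Rightarrow> real" where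
  "ndist E x y =
     (if x \<in> carrier E \<and> y \<in> carrier E then nrm E (x \<ominus>\<^bsub>E\<^esub> y) else 0)"

locale normed_space_on = Module.module real_ring E
  for E :: "'e nspace" +
  assumes nrm_nonneg: "x \<in> carrier E \<Longrightarrow> 0 \<le> nrm E x"
    and nrm_eq_0: "x \<in> carrier E \<Longrightarrow> nrm E x = 0 \<longleftrightarrow> x = \<zero>\<^bsub>E\<^esub>"
    and nrm_smult: "x \<in> carrier E \<Longrightarrow> nrm E (a \<odot>\<^bsub>E\<^esub> x) = \<bar>a\<bar> * nrm E x"
    and nrm_triangle:
      "x \<in> carrier E \<Longrightarrow> y \<in> carrier E \<Longrightarrow> nrm E (x \<oplus>\<^bsub>E\<^esub> y) \<le> nrm E x + nrm E y"

locale banach_space_on = normed_space_on E for E :: "'e nspace" +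
  assumes complete: "Metric_space.mcomplete (carrier E) (ndist E)"

definition norm_topology :: "'e nspace \<Rightarrow> 'e topology" where
  "norm_topology E = Metric_space.mtopology (carrier E) (ndist E)"

definition convex_in :: "'e nspace \<Rightarrow> 'e set \<Rightarrow> bool" where
  "convex_in E K \<longleftrightarrow> K \<subseteq> carrier E \<and>
     (\<forall>x\<in>K. \<forall>y\<in>K. \<forall>u\<ge>0. \<forall>v\<ge>0. u + v = 1 \<longrightarrow>
        u \<odot>\<^bsub>E\<^esub> x \<oplus>\<^bsub>E\<^esub> v \<odot>\<^bsub>E\<^esub> y \<in> K)"

text \<open>Consistency with the type classes: every Banach space type is an instance.\<close>

definition nspace_of_type :: "'e::real_normed_vector nspace" where
  "nspace_of_type = \<lparr>carrier = UNIV, monoid.mult = (\<lambda>x y. 0), one = 0,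
     ring.zero = 0, add = (+), module.smult = (*\<^sub>R), nrm = norm\<rparr>"

lemma abelian_group_nspace_of_type: "abelian_group (nspace_of_type :: 'e::real_normed_vector nspace)"
proof (rule abelian_groupI)
  fix x :: 'e
  assume "x \<in> carrier nspace_of_type"
  show "\<exists>y\<in>carrier nspace_of_type. y \<oplus>\<^bsub>nspace_of_type\<^esub> x = \<zero>\<^bsub>nspace_of_type\<^esub>"
    by (rule bexI[of _ "- x"]) (auto simp: nspace_of_type_def)
qed (auto simp: nspace_of_type_def algebra_simps)

lemma ndist_nspace_of_type: "ndist (nspace_of_type :: 'e::real_normed_vector nspace) = dist"
proof (intro ext)
  fix x y :: 'e
  interpret abelian_group "nspace_of_type :: 'e nspace" by (rule abelian_group_nspace_of_type)
  have "\<ominus>\<^bsub>nspace_of_type\<^esub> y = - y"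
    by (rule minus_equality) (auto simp: nspace_of_type_def)
  then show "ndist nspace_of_type x y = dist x y"
    by (simp add: ndist_def a_minus_def dist_norm) (simp add: nspace_of_type_def)
qed

lemma banach_space_on_nspace_of_type: "banach_space_on (nspace_of_type :: 'e::banach nspace)"
proof -
  have "Module.module real_ring (nspace_of_type :: 'e nspace)"
    by (rule moduleI[OF cring_real_ring abelian_group_nspace_of_type])
       (auto simp: real_ring_def nspace_of_type_def scaleR_add_left scaleR_add_right)
  moreover have "Metric_space.mcomplete (carrier nspace_of_type) (ndist (nspace_of_type :: 'e nspace))"
    unfolding ndist_nspace_of_type
    by (simp add: nspace_of_type_def complete_UNIV)
  ultimately show ?thesis
    by (intro banach_space_on.intro normed_space_on.intro normed_space_on_axioms.intro
          banach_space_on_axioms.intro)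
       (auto simp: nspace_of_type_def norm_triangle_ineq)
qed

lemma norm_topology_nspace_of_type:
  "norm_topology (nspace_of_type :: 'e::real_normed_vector nspace) = euclidean"
  by (simp add: norm_topology_def ndist_nspace_of_type) (simp add: nspace_of_type_def)

lemma convex_in_nspace_of_type: "convex_in nspace_of_type K \<longleftrightarrow> convex K"
  by (auto simp: convex_in_def convex_def nspace_of_type_def)


section \<open>Games in choice form\<close>

text \<open>
  The players are \<open>{1..n}\<close>. Profiles are extensional functions: \<open>x \<in> (\<Pi>\<^sub>E i\<in>{1..n}. X i)\<close>, with
  \<open>x\<^sub>-\<^sub>i\<close> rendered as \<open>restrict x (others n i)\<close> and \<open>(z, y\<^sub>i)\<close> as \<open>z(i := y\<^sub>i)\<close>.
\<close>

definition others :: "nat \<Rightarrow> nat \<Rightarrow> nat set" where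
  "others n i = {1..n} - {i}"

definition game_in_choice_form ::
    "nat \<Rightarrow> (nat \<Rightarrow> 'e set) \<Rightarrow> (nat \<Rightarrow> (nat \<Rightarrow> 'e) set) \<Rightarrow> bool" where
  "game_in_choice_form n X C \<longleftrightarrow>
     (\<forall>i\<in>{1..n}. X i \<noteq> {} \<and> C i \<noteq> {} \<and> C i \<subseteq> (\<Pi>\<^sub>E j\<in>{1..n}. X j))"

definition upper_section ::
    "(nat \<Rightarrow> 'e set) \<Rightarrow> (nat \<Rightarrow> (nat \<Rightarrow> 'e) set) \<Rightarrow> nat \<Rightarrow> (nat \<Rightarrow> 'e) \<Rightarrow> 'e set" where
  "upper_section X C i z = {y \<in> X i. z(i := y) \<in> C i}"

definition choice_domain ::
    "nat \<Rightarrow> (nat \<Rightarrow> 'e set) \<Rightarrow> (nat \<Rightarrow> (nat \<Rightarrow> 'e) set) \<Rightarrow> nat \<Rightarrow> (nat \<Rightarrow> 'e) set" where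
  "choice_domain n X C i = {z \<in> (\<Pi>\<^sub>E j\<in>others n i. X j). upper_section X C i z \<noteq> {}}"

definition equilibrium_in_choice ::
    "nat \<Rightarrow> (nat \<Rightarrow> 'e set) \<Rightarrow> (nat \<Rightarrow> (nat \<Rightarrow> 'e) set) \<Rightarrow> (nat \<Rightarrow> 'e) \<Rightarrow> bool" where
  "equilibrium_in_choice n X C x \<longleftrightarrow> x \<in> (\<Pi>\<^sub>E i\<in>{1..n}. X i) \<and>
     (\<forall>i\<in>{1..n}. upper_section X C i (restrict x (others n i)) \<noteq> {} \<longrightarrow>
        x i \<in> upper_section X C i (restrict x (others n i)))"

definition lower_semicontinuous_map ::
    "'a topology \<Rightarrow> 'b topology \<Rightarrow> ('a \<Rightarrow> 'b set) \<Rightarrow> bool" where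
  "lower_semicontinuous_map Z Y T \<longleftrightarrow>
     (\<forall>z\<in>topspace Z. T z \<subseteq> topspace Y) \<and>
     (\<forall>z\<in>topspace Z. \<forall>V. openin Y V \<and> T z \<inter> V \<noteq> {} \<longrightarrow>
        (\<exists>U. openin Z U \<and> z \<in> U \<and> (\<forall>z'\<in>U. T z' \<inter> V \<noteq> {})))"

definition strategy_topology ::
    "(nat \<Rightarrow> 'e nspace) \<Rightarrow> (nat \<Rightarrow> 'e set) \<Rightarrow> nat \<Rightarrow> 'e topology" where
  "strategy_topology E X i = subtopology (norm_topology (E i)) (X i)"

definition profile_topology ::
    "(nat \<Rightarrow> 'e nspace) \<Rightarrow> (nat \<Rightarrow> 'e set) \<Rightarrow> nat set \<Rightarrow> (nat \<Rightarrow> 'e) topology" where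
  "profile_topology E X J = product_topology (strategy_topology E X) J"

end

theory Submission
  imports Defs
begin

text \<open>
  Since \<open>C\<^sub>i\<close> is open and \<open>W\<^sub>i\<close> has the Lindelof property, the domain
  \<open>W\<^sub>i\<close> is covered by countably many open sets \<open>V\<^sub>i\<^sub>k\<close> with functions \<open>\<phi>\<^sub>i\<^sub>k\<close> that are \<open>1\<close> on
  \<open>V\<^sub>i\<^sub>k\<close> and points \<open>y\<^sub>i\<^sub>k\<close> that belong to \<open>C\<^sub>i(z)\<close> wherever \<open>\<phi>\<^sub>i\<^sub>k(z) \<noteq> 0\<close>. The blend
  \<open>\<phi>\<^sub>0 y\<^sub>0 + (1 - \<phi>\<^sub>0) (\<phi>\<^sub>1 y\<^sub>1 + (1 - \<phi>\<^sub>1) (\<dots>))\<close>, cut off after \<open>m\<close> terms, no longer depends on \<open>m > k\<close>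
  on \<open>V\<^sub>i\<^sub>k\<close>, where it selects from the convex set \<open>C\<^sub>i(z)\<close>. For each \<open>m\<close>, a fixed point of the
  weights, viewed as a self-map of the Hilbert cube, gives a profile in which every player plays
  the cut-off blend. The sets \<open>A\<^sub>m\<close> of profiles with \<open>x\<^sub>i\<close> equal to the blend whenever
  \<open>x\<^sub>-\<^sub>i \<in> V\<^sub>i\<^sub>k\<close>, \<open>k < m\<close>, are therefore nonempty, closed and decreasing, and every common point
  of them is an equilibrium.
\<close>

subsection \<open>Convex combinations in normed spaces\<close>

context normed_space_on begin

section \<open>Scalar laws over the reals and the metric of the norm\<close>

lemma smult_carrier [simp]: "x \<in> carrier E \<Longrightarrow> a \<odot>\<^bsub>E\<^esub> x \<in> carrier E"
  using smult_closed[of a x] by (simp add: real_ring_def)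

lemma smult_add_left: "x \<in> carrier E \<Longrightarrow> (a + b) \<odot>\<^bsub>E\<^esub> x = a \<odot>\<^bsub>E\<^esub> x \<oplus>\<^bsub>E\<^esub> b \<odot>\<^bsub>E\<^esub> x"
  using smult_l_distr[of a b x] by (simp add: real_ring_def)

lemma smult_add_right:
  "x \<in> carrier E \<Longrightarrow> y \<in> carrier E \<Longrightarrow> a \<odot>\<^bsub>E\<^esub> (x \<oplus>\<^bsub>E\<^esub> y) = a \<odot>\<^bsub>E\<^esub> x \<oplus>\<^bsub>E\<^esub> a \<odot>\<^bsub>E\<^esub> y"
  using smult_r_distr[of a x y] by (simp add: real_ring_def)

lemma smult_one_left: "x \<in> carrier E \<Longrightarrow> 1 \<odot>\<^bsub>E\<^esub> x = x"
  using smult_one[of x] by (simp add: real_ring_def)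

lemma smult_zero_left: "x \<in> carrier E \<Longrightarrow> 0 \<odot>\<^bsub>E\<^esub> x = \<zero>\<^bsub>E\<^esub>"
  using smult_l_null[of x] by (simp add: real_ring_def)

lemma smult_uminus_left: "x \<in> carrier E \<Longrightarrow> (- a) \<odot>\<^bsub>E\<^esub> x = \<ominus>\<^bsub>E\<^esub> (a \<odot>\<^bsub>E\<^esub> x)"
  by (metis M.minus_equality add.left_inverse smult_add_left smult_carrier smult_zero_left)

lemma smult_uminus_right: "x \<in> carrier E \<Longrightarrow> a \<odot>\<^bsub>E\<^esub> (\<ominus>\<^bsub>E\<^esub> x) = \<ominus>\<^bsub>E\<^esub> (a \<odot>\<^bsub>E\<^esub> x)"
  using smult_r_minus[of a x] by (simp add: real_ring_def)

lemma nrm_uminus: "x \<in> carrier E \<Longrightarrow> nrm E (\<ominus>\<^bsub>E\<^esub> x) = nrm E x"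
  by (metis abs_minus_cancel abs_one mult_1 nrm_smult smult_one_left smult_uminus_left)

sublocale norm_metric: Metric_space "carrier E" "ndist E"
proof
  show "0 \<le> ndist E x y" for x y
    by (simp add: ndist_def nrm_nonneg)
  show "ndist E x y = ndist E y x" for x y
  proof -
    have "nrm E (x \<ominus>\<^bsub>E\<^esub> y) = nrm E (y \<ominus>\<^bsub>E\<^esub> x)" if "x \<in> carrier E" "y \<in> carrier E"
    proof -
      have "\<ominus>\<^bsub>E\<^esub> (x \<ominus>\<^bsub>E\<^esub> y) = y \<ominus>\<^bsub>E\<^esub> x"
        using that by (simp add: a_minus_def M.minus_add M.a_comm)
      then show ?thesis
        using that by (metis M.minus_closed nrm_uminus)
    qed
    then show ?thesis by (simp add: ndist_def)
  qed
  show "ndist E x y = 0 \<longleftrightarrow> x = y" if "x \<in> carrier E" "y \<in> carrier E" for x y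
  proof -
    have "x = y" if "x \<ominus>\<^bsub>E\<^esub> y = \<zero>\<^bsub>E\<^esub>"
      using that \<open>x \<in> carrier E\<close> \<open>y \<in> carrier E\<close>
      by (metis M.a_inv_closed M.minus_equality M.minus_minus a_minus_def)
    then show ?thesis
      using that by (auto simp: ndist_def nrm_eq_0 a_minus_def M.r_neg)
  qed
  show "ndist E x z \<le> ndist E x y + ndist E y z"
    if "x \<in> carrier E" "y \<in> carrier E" "z \<in> carrier E" for x y z
  proof -
    have "x \<ominus>\<^bsub>E\<^esub> z = (x \<ominus>\<^bsub>E\<^esub> y) \<oplus>\<^bsub>E\<^esub> (y \<ominus>\<^bsub>E\<^esub> z)"
      using that by (simp add: a_minus_def M.a_assoc M.r_neg1)
    then show ?thesis
      using that by (simp add: ndist_def nrm_triangle)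
  qed
qed

lemma mtopology_eq_norm_topology: "norm_metric.mtopology = norm_topology E"
  by (simp add: norm_topology_def)

lemma topspace_norm_topology [simp]: "topspace (norm_topology E) = carrier E"
  by (simp flip: mtopology_eq_norm_topology)

section \<open>Mixtures of two points and their iteration\<close>

definition mix :: "real \<Rightarrow> 'e \<Rightarrow> 'e \<Rightarrow> 'e" where
  "mix c x u = c \<odot>\<^bsub>E\<^esub> x \<oplus>\<^bsub>E\<^esub> (1 - c) \<odot>\<^bsub>E\<^esub> u"

lemma mix_carrier [simp]: "x \<in> carrier E \<Longrightarrow> u \<in> carrier E \<Longrightarrow> mix c x u \<in> carrier E"
  by (simp add: mix_def)

lemma mix_0 [simp]: "x \<in> carrier E \<Longrightarrow> u \<in> carrier E \<Longrightarrow> mix 0 x u = u"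
  by (simp add: mix_def smult_zero_left smult_one_left)

lemma mix_1 [simp]: "x \<in> carrier E \<Longrightarrow> u \<in> carrier E \<Longrightarrow> mix 1 x u = x"
  by (simp add: mix_def smult_zero_left smult_one_left)

lemma mix_in_convex:
  assumes "convex_in E K" "x \<in> K" "u \<in> K" "0 \<le> c" "c \<le> 1"
  shows "mix c x u \<in> K"
  using assms unfolding convex_in_def mix_def by auto

text \<open>The comparison passes through \<open>mix d x u\<close>: changing the weight moves the
  point by \<open>(c - d)(x - u)\<close>, and replacing \<open>u\<close> by \<open>v\<close> moves
  it by \<open>(1 - d)(u - v)\<close>.\<close>

lemma ndist_mix_le:
  assumes [simp]: "x \<in> carrier E" "u \<in> carrier E" "v \<in> carrier E"
  shows "ndist E (mix c x u) (mix d x v) \<le> \<bar>c - d\<bar> * ndist E x u + \<bar>1 - d\<bar> * ndist E u v"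
proof -
  have diff: "a \<odot>\<^bsub>E\<^esub> y \<ominus>\<^bsub>E\<^esub> b \<odot>\<^bsub>E\<^esub> y = (a - b) \<odot>\<^bsub>E\<^esub> y" if "y \<in> carrier E" for a b y
    using smult_add_left[of y a "- b"] that by (simp add: smult_uminus_left a_minus_def)
  have diff': "a \<odot>\<^bsub>E\<^esub> y \<ominus>\<^bsub>E\<^esub> a \<odot>\<^bsub>E\<^esub> z = a \<odot>\<^bsub>E\<^esub> (y \<ominus>\<^bsub>E\<^esub> z)"
    if "y \<in> carrier E" "z \<in> carrier E" for a y z
    using that by (simp add: smult_add_right smult_uminus_right a_minus_def)
  have split: "(1 - c) \<odot>\<^bsub>E\<^esub> u = (1 - d) \<odot>\<^bsub>E\<^esub> u \<ominus>\<^bsub>E\<^esub> (c - d) \<odot>\<^bsub>E\<^esub> u"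
    by (simp add: diff)
  have "mix c x u \<ominus>\<^bsub>E\<^esub> mix d x v =
      (c \<odot>\<^bsub>E\<^esub> x \<ominus>\<^bsub>E\<^esub> d \<odot>\<^bsub>E\<^esub> x \<ominus>\<^bsub>E\<^esub> (c - d) \<odot>\<^bsub>E\<^esub> u) \<oplus>\<^bsub>E\<^esub>
      ((1 - d) \<odot>\<^bsub>E\<^esub> u \<ominus>\<^bsub>E\<^esub> (1 - d) \<odot>\<^bsub>E\<^esub> v)"
    by (simp add: mix_def split a_minus_def M.minus_add M.a_ac)
  also have "\<dots> = (c - d) \<odot>\<^bsub>E\<^esub> (x \<ominus>\<^bsub>E\<^esub> u) \<oplus>\<^bsub>E\<^esub> (1 - d) \<odot>\<^bsub>E\<^esub> (u \<ominus>\<^bsub>E\<^esub> v)"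
    by (simp add: diff diff')
  finally have "mix c x u \<ominus>\<^bsub>E\<^esub> mix d x v =
      (c - d) \<odot>\<^bsub>E\<^esub> (x \<ominus>\<^bsub>E\<^esub> u) \<oplus>\<^bsub>E\<^esub> (1 - d) \<odot>\<^bsub>E\<^esub> (u \<ominus>\<^bsub>E\<^esub> v)" .
  then show ?thesis
    using nrm_triangle[of "(c - d) \<odot>\<^bsub>E\<^esub> (x \<ominus>\<^bsub>E\<^esub> u)" "(1 - d) \<odot>\<^bsub>E\<^esub> (u \<ominus>\<^bsub>E\<^esub> v)"]
    by (simp add: ndist_def nrm_smult)
qed

text \<open>In \<open>ndist_mix_le\<close> the weight difference is multiplied by the fixed number
  \<open>ndist E x (u t)\<close>, and the second factor is at most \<open>1\<close> because weights
  stay in \<open>{0..1}\<close>.\<close>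

lemma continuous_map_mix:
  assumes c: "continuous_map T (top_of_set {0..1}) c" and u: "continuous_map T (norm_topology E) u"
    and x: "x \<in> carrier E"
  shows "continuous_map T (norm_topology E) (\<lambda>t. mix (c t) x (u t))"
  unfolding mtopology_eq_norm_topology[symmetric] norm_metric.continuous_map_to_metric
proof (intro ballI allI impI)
  fix t and \<epsilon> :: real
  assume t: "t \<in> topspace T" and "0 < \<epsilon>"
  have uc: "u s \<in> carrier E" if "s \<in> topspace T" for s
    using continuous_map_image_subset_topspace[OF u] that by auto
  have c01: "0 \<le> c s \<and> c s \<le> 1" if "s \<in> topspace T" for s
    using continuous_map_image_subset_topspace[OF c] that by auto
  define r where "r = ndist E x (u t)"
  have "r \<ge> 0" by (simp add: r_def)
  \<comment> \<open>The \<open>+ 1\<close> keeps \<open>\<delta>\<close> well-defined and positive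
    when \<open>x = u t\<close>; in all cases
    \<open>\<delta> * r \<le> \<epsilon> / 2\<close>.\<close>
  define \<delta> where "\<delta> = \<epsilon> / (2 * (r + 1))"
  have "\<delta> > 0" using \<open>0 < \<epsilon>\<close> \<open>r \<ge> 0\<close> by (simp add: \<delta>_def)
  have "continuous_map T euclidean c"
    using c by (simp add: continuous_map_in_subtopology)
  then have "openin T {s \<in> topspace T. c s \<in> ball (c t) \<delta>}"
    by (rule openin_continuous_map_preimage) simp
  moreover have "t \<in> {s \<in> topspace T. c s \<in> ball (c t) \<delta>}"
    using \<open>\<delta> > 0\<close> t by simp
  ultimately obtain U where U: "openin T U" "t \<in> U" "\<And>s. s \<in> U \<Longrightarrow> c s \<in> ball (c t) \<delta>"
    by blast
  have "\<exists>V. openin T V \<and> t \<in> V \<and> (\<forall>s\<in>V. u s \<in> norm_metric.mball (u t) e)" if "e > 0" for e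
    using u t that unfolding mtopology_eq_norm_topology[symmetric] norm_metric.continuous_map_to_metric
    by simp
  from this[OF half_gt_zero[OF \<open>0 < \<epsilon>\<close>]]
  obtain V where V: "openin T V" "t \<in> V" "\<And>s. s \<in> V \<Longrightarrow> u s \<in> norm_metric.mball (u t) (\<epsilon> / 2)"
    by (elim exE conjE) simp
  show "\<exists>U. openin T U \<and> t \<in> U \<and>
      (\<forall>s\<in>U. mix (c s) x (u s) \<in> norm_metric.mball (mix (c t) x (u t)) \<epsilon>)"
  proof (intro exI conjI ballI)
    show "openin T (U \<inter> V)" "t \<in> U \<inter> V" using U V by auto
    fix s assume s: "s \<in> U \<inter> V"
    then have sT: "s \<in> topspace T" using U(1) openin_subset by blast
    have "ndist E (mix (c t) x (u t)) (mix (c s) x (u s))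
        \<le> \<bar>c t - c s\<bar> * r + \<bar>1 - c s\<bar> * ndist E (u t) (u s)"
      unfolding r_def using ndist_mix_le x uc t sT by blast
    also have "\<dots> < \<epsilon>"
    proof -
      have "\<bar>c t - c s\<bar> * r \<le> \<delta> * r"
        using U(3)[of s] s \<open>r \<ge> 0\<close> by (intro mult_right_mono) (auto simp: dist_real_def)
      also have "\<dots> \<le> \<epsilon> / 2"
        using \<open>r \<ge> 0\<close> \<open>0 < \<epsilon>\<close> by (simp add: \<delta>_def field_simps)
      finally have "\<bar>c t - c s\<bar> * r \<le> \<epsilon> / 2" .
      moreover have "\<bar>1 - c s\<bar> * ndist E (u t) (u s) \<le> 1 * ndist E (u t) (u s)"
        using c01[OF sT] by (intro mult_right_mono) auto
      moreover have "ndist E (u t) (u s) < \<epsilon> / 2"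
        using V(3)[of s] s by auto
      ultimately show ?thesis by simp
    qed
    finally show "mix (c s) x (u s) \<in> norm_metric.mball (mix (c t) x (u t)) \<epsilon>"
      using x uc t sT by simp
  qed
qed

text \<open>Stick-breaking: term \<open>j\<close> takes the share \<open>s j\<close> of what the
  earlier terms leave, and the default point \<open>p\<close> takes the remainder. Recursion at the
  head puts the cut-off at the innermost place, where a full share can hide it.\<close>

primrec blend :: "nat \<Rightarrow> (nat \<Rightarrow> real) \<Rightarrow> (nat \<Rightarrow> 'e) \<Rightarrow> 'e \<Rightarrow> 'e" where
  "blend 0 s y p = p"
| "blend (Suc m) s y p = mix (s 0) (y 0) (blend m (\<lambda>j. s (Suc j)) (\<lambda>j. y (Suc j)) p)"

lemma blend_in_convex:
  assumes "convex_in E K" "\<And>j. y j \<in> K" "p \<in> K" "\<And>j. s j \<in> {0..1}"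
  shows "blend m s y p \<in> K"
  using assms
proof (induction m arbitrary: s y)
  case (Suc m)
  then show ?case
    using mix_in_convex[of K "y 0"] Suc.IH[of "\<lambda>j. y (Suc j)" "\<lambda>j. s (Suc j)"] by auto
qed auto

lemma blend_carrier: "(\<And>j. y j \<in> carrier E) \<Longrightarrow> p \<in> carrier E \<Longrightarrow> blend m s y p \<in> carrier E"
  by (induction m arbitrary: s y) auto

text \<open>A share of \<open>1\<close> at \<open>k\<close> leaves nothing for the later terms or
  for \<open>p\<close>.\<close>

lemma blend_truncate:
  assumes "\<And>j. y j \<in> carrier E" "p \<in> carrier E" "s k = 1" "k < m"
  shows "blend m s y p = blend (Suc k) s y p"
  using assms
proof (induction m arbitrary: s y k)
  case (Suc m)
  then show ?case
    by (cases k) (auto simp: blend_carrier)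
qed auto

text \<open>Terms of weight \<open>0\<close> drop out, and \<open>s k = 1\<close> leaves no share
  for \<open>p\<close>; so the result is a convex combination of points of \<open>K\<close> alone,
  even if \<open>p\<close> and some \<open>y j\<close> lie outside \<open>K\<close>.\<close>

lemma blend_in_support:
  assumes "convex_in E K" "\<And>j. y j \<in> carrier E" "p \<in> carrier E" "\<And>j. s j \<in> {0..1}"
    and "\<And>j. s j \<noteq> 0 \<Longrightarrow> y j \<in> K" "s k = 1"
  shows "blend (Suc k) s y p \<in> K"
  using assms
proof (induction k arbitrary: s y)
  case 0
  then show ?case by (metis blend.simps mix_1 zero_neq_one)
next
  case (Suc k)
  let ?b = "blend (Suc k) (\<lambda>j. s (Suc j)) (\<lambda>j. y (Suc j)) p"
  have b: "?b \<in> K" by (rule Suc.IH) (use Suc.prems in auto)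
  then have "mix (s 0) (y 0) ?b \<in> K"
  proof (cases "s 0 = 0")
    case True
    have "?b \<in> carrier E" by (rule blend_carrier) (use Suc.prems in auto)
    then show ?thesis using True b Suc.prems(2) by (metis mix_0)
  next
    case False
    then show ?thesis using mix_in_convex[of K "y 0" ?b "s 0"] Suc.prems b by auto
  qed
  then show ?case by (metis blend.simps(2))
qed

lemma continuous_map_blend:
  assumes "\<And>j. continuous_map T (top_of_set {0..1}) (\<lambda>t. s t j)"
    and "\<And>j. y j \<in> carrier E" "p \<in> carrier E"
  shows "continuous_map T (norm_topology E) (\<lambda>t. blend m (s t) y p)"
  using assms
proof (induction m arbitrary: s y)
  case (Suc m)
  then show ?case
    using continuous_map_mix[of T "\<lambda>t. s t 0" "\<lambda>t. blend m (\<lambda>j. s t (Suc j)) (\<lambda>j. y (Suc j)) p" "y 0"]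
    by simp
qed auto

end

subsection \<open>Plateau functions and the fixed point theorem for the Hilbert cube\<close>

text \<open>In a metrizable space an open set is a countable union of closed sets. These are compact
  here, and a countable union of Lindelof sets is Lindelof.\<close>

lemma openin_compact_metrizable_imp_Lindelof:
  assumes "compact_space T" "metrizable_space T" "openin T W"
  shows "Lindelof_space (subtopology T W)"
proof -
  obtain \<U> where \<U>: "countable \<U>" "\<And>U. U \<in> \<U> \<Longrightarrow> closedin T U" "\<Union>\<U> = W"
    using open_imp_fsigma_in[OF assms(2,3)] unfolding fsigma_in_def union_of_def by auto
  have "Lindelof_space (subtopology T (\<Union>\<U>))"
    by (rule Lindelof_space_Union)
      (use \<U> assms(1) in \<open>auto intro!: compact_imp_Lindelof_space compact_space_subtopology
          closedin_compact_space\<close>)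
  then show ?thesis using \<U> by simp
qed

text \<open>Each point of \<open>W\<close> has a value \<open>y\<close> that stays admissible on an
  open set; complete regularity supplies a function supported there, and the Lindelof property
  leaves countably many. Nonemptiness of \<open>V k\<close> ensures that each \<open>y k\<close> is
  admissible somewhere.\<close>

lemma countable_plateau_functions:
  fixes G :: "'a \<Rightarrow> 'b set"
  assumes T: "compact_space T" "metrizable_space T" and W: "openin T W" "W \<noteq> {}"
    and G: "\<And>z. z \<in> W \<Longrightarrow> \<exists>y. y \<in> G z \<and> openin T {w \<in> topspace T. y \<in> G w}"
  obtains y :: "nat \<Rightarrow> 'b" and \<phi> :: "nat \<Rightarrow> 'a \<Rightarrow> real" and V :: "nat \<Rightarrow> 'a set"
  where "\<And>k. continuous_map T (top_of_set {0..1}) (\<phi> k)"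
    and "\<And>k z. z \<in> topspace T \<Longrightarrow> \<phi> k z \<noteq> 0 \<Longrightarrow> y k \<in> G z"
    and "\<And>k. openin T (V k)" and "\<And>k z. z \<in> V k \<Longrightarrow> \<phi> k z = 1" and "W \<subseteq> (\<Union>k. V k)"
    and "\<And>k. V k \<noteq> {}"
proof -
  define good where "good V y \<phi> \<longleftrightarrow> openin T V \<and> V \<noteq> {} \<and> continuous_map T (top_of_set {0..1::real}) \<phi> \<and>
      (\<forall>z\<in>topspace T. \<phi> z \<noteq> 0 \<longrightarrow> y \<in> G z) \<and> (\<forall>z\<in>V. \<phi> z = 1)" for V y \<phi>
  define \<V> where "\<V> = {V. V \<subseteq> W \<and> (\<exists>y \<phi>. good V y \<phi>)}"
  have cov: "\<exists>V\<in>\<V>. z \<in> V" if z: "z \<in> W" for z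
  proof -
    obtain y where y: "y \<in> G z" "openin T {w \<in> topspace T. y \<in> G w}"
      using G z by blast
    let ?U = "{w \<in> topspace T. y \<in> G w}"
    have zT: "z \<in> topspace T" using W(1) z openin_subset by blast
    have "closedin T (topspace T - ?U)" "z \<in> topspace T - (topspace T - ?U)"
      using y zT by auto
    \<comment> \<open>\<open>f\<close> separates \<open>z\<close>, where it is \<open>0\<close>,
      from the complement of \<open>?U\<close>, where it is \<open>1\<close>.\<close>
    then obtain f :: "'a \<Rightarrow> real" where f: "continuous_map T (top_of_set {0..1}) f" "f z = 0"
        "f ` (topspace T - ?U) \<subseteq> {1}"
      using metrizable_imp_completely_regular_space[OF T(2)] unfolding completely_regular_space_def
      by meson
    have f': "continuous_map T euclideanreal f" "\<And>w. w \<in> topspace T \<Longrightarrow> 0 \<le> f w \<and> f w \<le> 1"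
      using f(1) by (auto simp: continuous_map_in_subtopology)
    let ?V = "{w \<in> topspace T. f w \<in> {..<1/2}} \<inter> W"
    \<comment> \<open>The cut at \<open>1\<close> turns the separating function into a plateau: the
      value is exactly \<open>1\<close> where \<open>f \<le> 1/2\<close>, and \<open>0\<close> where
      \<open>f = 1\<close>.\<close>
    let ?\<phi> = "\<lambda>w. min 1 (2 - 2 * f w)"
    have "openin T ?V"
      by (intro openin_Int openin_continuous_map_preimage[OF f'(1)] W) auto
    moreover have "continuous_map T euclideanreal ?\<phi>"
      using f'(1) by (intro continuous_intros) auto
    then have "continuous_map T (top_of_set {0..1}) ?\<phi>"
      using f'(2) by (auto simp: continuous_map_in_subtopology)
    moreover have "\<forall>w\<in>topspace T. ?\<phi> w \<noteq> 0 \<longrightarrow> y \<in> G w"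
    proof (intro ballI impI)
      fix w assume w: "w \<in> topspace T" "?\<phi> w \<noteq> 0"
      then have "f w \<noteq> 1" by auto
      with f(3) w(1) have "w \<in> ?U" by blast
      then show "y \<in> G w" by simp
    qed
    moreover have zV: "z \<in> ?V" using f(2) z zT by simp
    moreover have "\<forall>w\<in>?V. ?\<phi> w = 1" by auto
    ultimately have "good ?V y ?\<phi>" unfolding good_def by (intro conjI) auto
    then have "?V \<in> \<V>" unfolding \<V>_def by (intro CollectI conjI exI) auto
    then show ?thesis using zV by (rule bexI[rotated])
  qed
  have top: "topspace (subtopology T W) = W"
    using openin_subset[OF W(1)] by (simp add: Int_absorb1)
  have "\<Union>\<V> = topspace (subtopology T W)"
    unfolding top using cov by (auto simp: \<V>_def)
  moreover have "openin (subtopology T W) V" if "V \<in> \<V>" for V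
  proof -
    obtain y \<phi> where "V \<subseteq> W" "good V y \<phi>" using \<open>V \<in> \<V>\<close> unfolding \<V>_def by blast
    then show ?thesis by (simp add: good_def openin_open_subtopology[OF W(1)])
  qed
  ultimately have "\<exists>\<W>. countable \<W> \<and> \<W> \<subseteq> \<V> \<and> \<Union>\<W> = topspace (subtopology T W)"
    by (intro Lindelof_spaceD[OF openin_compact_metrizable_imp_Lindelof[OF T W(1)]])
  then obtain \<W> where \<W>: "countable \<W>" "\<W> \<subseteq> \<V>" "\<Union>\<W> = W"
    unfolding top by (elim exE conjE)
  then have "\<W> \<noteq> {}" using W(2) by auto
  \<comment> \<open>The enumeration may repeat members, so a finite \<open>\<W>\<close> is covered
    too.\<close>
  define V where "V = from_nat_into \<W>"
  have ran: "range V = \<W>" unfolding V_def using \<open>\<W> \<noteq> {}\<close> \<W>(1) by (rule range_from_nat_into)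
  then have "\<forall>k. \<exists>y \<phi>. good (V k) y \<phi>" using \<W>(2) unfolding \<V>_def by blast
  then obtain y \<phi> where g: "\<And>k. good (V k) (y k) (\<phi> k)" by metis
  show thesis
    by (rule that[of \<phi> y V]) (use g ran \<W>(3) in \<open>simp_all add: good_def\<close>)
qed

text \<open>
  Kuhn's lemma in dimension \<open>N\<close> on a grid of mesh \<open>1 / (N + 1)\<close>, with the remaining coordinates
  set to \<open>0\<close>, gives points near which \<open>f x i - x i\<close> changes sign for every \<open>i < N\<close>; their
  limit points are fixed.
\<close>

theorem brouwer_Hilbert_cube:
  fixes f :: "(nat \<Rightarrow> real) \<Rightarrow> nat \<Rightarrow> real"
  assumes cont: "continuous_on (PiE UNIV (\<lambda>_. {0..1})) f"
    and self: "f \<in> PiE UNIV (\<lambda>_. {0..1}) \<rightarrow> PiE UNIV (\<lambda>_. {0..1})"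
  obtains x where "x \<in> PiE UNIV (\<lambda>_. {0..1})" "f x = x"
proof -
  define Q :: "(nat \<Rightarrow> real) set" where "Q = PiE UNIV (\<lambda>_. {0..1})"
  have Q: "x \<in> Q \<longleftrightarrow> (\<forall>i. 0 \<le> x i \<and> x i \<le> 1)" for x
    by (auto simp: Q_def PiE_def Pi_def)
  have "compactin (product_topology (\<lambda>_. euclideanreal) UNIV) Q"
    unfolding Q_def by (simp add: compactin_PiE)
  \<comment> \<open>The index type is countable, so the product topology is metric and compactness
    yields convergent subsequences.\<close>
  then have "seq_compact Q"
    by (simp add: euclidean_product_topology compact_eq_seq_compact_metric)
  have lim: "X \<longlonglongrightarrow> x \<longleftrightarrow> (\<forall>i. (\<lambda>n. X n i) \<longlonglongrightarrow> x i)" for X and x :: "nat \<Rightarrow> real"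
    using limitin_componentwise[of "\<lambda>_. euclideanreal" UNIV X x sequentially]
    by (simp add: euclidean_product_topology)
  \<comment> \<open>Label \<open>0\<close> means that \<open>f\<close> does not lower the
    coordinate, label \<open>1\<close> that it does not raise it. The conjunct \<open>True\<close>
    stands for the coordinate predicate of \<open>kuhn_labelling_lemma'\<close>: all coordinates are
    labelled.\<close>
  have "\<exists>l. (\<forall>x i. l x i \<le> (1::nat)) \<and>
             (\<forall>x i. x \<in> Q \<and> True \<and> x i = 0 \<longrightarrow> l x i = 0) \<and>
             (\<forall>x i. x \<in> Q \<and> True \<and> x i = 1 \<longrightarrow> l x i = 1) \<and>
             (\<forall>x i. x \<in> Q \<and> True \<and> l x i = 0 \<longrightarrow> x i \<le> f x i) \<and>
             (\<forall>x i. x \<in> Q \<and> True \<and> l x i = 1 \<longrightarrow> f x i \<le> x i)"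
    by (rule kuhn_labelling_lemma') (use self in \<open>auto simp: Q Pi_iff simp flip: Q_def\<close>)
  then obtain l where l: "\<And>x i. l x i \<le> (1::nat)"
      "\<And>x i. x \<in> Q \<Longrightarrow> x i = 0 \<Longrightarrow> l x i = 0" "\<And>x i. x \<in> Q \<Longrightarrow> x i = 1 \<Longrightarrow> l x i = 1"
      "\<And>x i. x \<in> Q \<Longrightarrow> l x i = 0 \<Longrightarrow> x i \<le> f x i" "\<And>x i. x \<in> Q \<Longrightarrow> l x i = 1 \<Longrightarrow> f x i \<le> x i"
    by blast
  \<comment> \<open>The points \<open>a\<close> and \<open>b\<close> witness the two signs of
    \<open>f x i - x i\<close> within one mesh width of \<open>u\<close>.\<close>
  define bracket where "bracket N u i a b \<longleftrightarrow> a \<in> Q \<and> b \<in> Q \<and> a i \<le> f a i \<and> f b i \<le> b i \<and>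
      (\<forall>j. \<bar>a j - u j\<bar> \<le> 1 / Suc N \<and> \<bar>b j - u j\<bar> \<le> 1 / Suc N)" for N u i a b
  have "\<exists>u. u \<in> Q \<and> (\<forall>i<N. \<exists>a b. bracket N u i a b)" for N
  proof -
    \<comment> \<open>A grid vertex. With \<open>Suc N\<close> subdivisions the mesh is defined for
      \<open>N = 0\<close> and tends to \<open>0\<close> while the number of active coordinates
      grows.\<close>
    define pt where "pt x = (\<lambda>i. if i < N then real (x i) / Suc N else 0)" for x :: "nat \<Rightarrow> nat"
    have ptQ: "pt x \<in> Q" if "\<forall>i<N. x i \<le> Suc N" for x
          proof -
      have "real (x i) \<le> real (Suc N)" if "i < N" for i
        unfolding of_nat_le_iff using \<open>\<forall>i<N. x i \<le> Suc N\<close> that by blast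
      then show ?thesis by (auto simp: Q pt_def divide_le_eq_1 simp del: of_nat_Suc)
    qed
    \<comment> \<open>Kuhn's lemma: some cell with lower corner \<open>q\<close> has, in every
      active coordinate, two vertices with different labels.\<close>
    obtain q where q: "\<forall>i<N. q i < Suc N"
      "\<forall>i<N. \<exists>r s. (\<forall>j<N. q j \<le> r j \<and> r j \<le> q j + 1) \<and> (\<forall>j<N. q j \<le> s j \<and> s j \<le> q j + 1) \<and>
         l (pt r) i \<noteq> l (pt s) i"
    proof (rule kuhn_lemma[of "Suc N" N "\<lambda>x. l (pt x)"])
      show "\<forall>x. (\<forall>i<N. x i \<le> Suc N) \<longrightarrow> (\<forall>i<N. l (pt x) i = 0 \<or> l (pt x) i = 1)"
        using l(1) by (metis One_nat_def le_Suc_eq le_zero_eq)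
      show "\<forall>x. (\<forall>i<N. x i \<le> Suc N) \<longrightarrow> (\<forall>i<N. x i = 0 \<longrightarrow> l (pt x) i = 0)"
        using ptQ by (auto intro!: l(2) simp: pt_def)
      show "\<forall>x. (\<forall>i<N. x i \<le> Suc N) \<longrightarrow> (\<forall>i<N. x i = Suc N \<longrightarrow> l (pt x) i = 1)"
      proof (intro allI impI)
        fix x i assume "\<forall>i<N. x i \<le> Suc N" "i < N" "x i = Suc N"
        then show "l (pt x) i = 1" by (intro l(3) ptQ) (simp_all add: pt_def del: of_nat_Suc)
      qed
    qed auto
    show ?thesis
    proof (rule exI[of _ "pt q"], intro conjI allI impI)
      show "pt q \<in> Q" using q(1) by (intro ptQ) auto
      fix i assume "i < N"
      then obtain r s where rs: "\<forall>j<N. q j \<le> r j \<and> r j \<le> q j + 1" "\<forall>j<N. q j \<le> s j \<and> s j \<le> q j + 1"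
         "l (pt r) i \<noteq> l (pt s) i" using q(2) by blast
      have near: "pt t \<in> Q \<and> (\<forall>j. \<bar>pt t j - pt q j\<bar> \<le> 1 / Suc N)"
        if t: "\<forall>j<N. q j \<le> t j \<and> t j \<le> q j + 1" for t
      proof
        show "pt t \<in> Q" using t q(1) by (intro ptQ) fastforce
        show "\<forall>j. \<bar>pt t j - pt q j\<bar> \<le> 1 / Suc N"
        proof
          fix j
          show "\<bar>pt t j - pt q j\<bar> \<le> 1 / Suc N"
          proof (cases "j < N")
            case True
            then have "\<bar>real (t j) - real (q j)\<bar> \<le> 1" using t by force
            then show ?thesis using True
              by (simp add: pt_def divide_right_mono flip: diff_divide_distrib)
          qed (simp add: pt_def)
        qed
      qed
      note nr = near[OF rs(1)] and ns = near[OF rs(2)]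
      \<comment> \<open>The two labels are \<open>0\<close> and \<open>1\<close> in some order; the
        vertex labelled \<open>0\<close> serves as \<open>a\<close>.\<close>
      show "\<exists>a b. bracket N (pt q) i a b"
      proof (cases "l (pt r) i = 0")
        case True
        then have "l (pt s) i = 1" using l(1)[of "pt s" i] rs(3) by linarith
        then have "pt r i \<le> f (pt r) i" "f (pt s) i \<le> pt s i" using True l(4,5) nr ns by auto
        then have "bracket N (pt q) i (pt r) (pt s)" using nr ns by (simp add: bracket_def)
        then show ?thesis by (intro exI)
      next
        case False
        then have "l (pt r) i = 1" "l (pt s) i = 0"
          using l(1)[of "pt r" i] l(1)[of "pt s" i] rs(3) by linarith+
        then have "pt s i \<le> f (pt s) i" "f (pt r) i \<le> pt r i" using l(4,5) nr ns by auto
        then have "bracket N (pt q) i (pt s) (pt r)" using nr ns by (simp add: bracket_def)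
        then show ?thesis by (intro exI)
      qed
    qed
  qed
  then obtain u where u: "\<And>N. u N \<in> Q" "\<And>N i. i < N \<Longrightarrow> \<exists>a b. bracket N (u N) i a b"
    by metis
  obtain x \<rho> where x: "x \<in> Q" "strict_mono \<rho>" "(u \<circ> \<rho>) \<longlonglongrightarrow> x"
    using seq_compactE[OF \<open>seq_compact Q\<close>, of u] u(1) by metis
  \<comment> \<open>A sequence that stays within the mesh of \<open>u \<circ> \<rho>\<close> has the
    same limit. Closeness for \<open>i < \<rho> n\<close> suffices, since this holds
    eventually.\<close>
  have flim: "(\<lambda>n. f (c n) i) \<longlonglongrightarrow> f x i \<and> (\<lambda>n. c n i) \<longlonglongrightarrow> x i"
    if c: "\<And>n. c n \<in> Q" "\<And>n j. i < \<rho> n \<Longrightarrow> \<bar>c n j - u (\<rho> n) j\<bar> \<le> 1 / Suc (\<rho> n)" for c i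
  proof -
    have ev: "eventually (\<lambda>n. i < \<rho> n) sequentially"
      by (rule eventually_compose_filterlim[OF eventually_gt_at_top filterlim_subseq[OF x(2)]])
    have z: "(\<lambda>n. 1 / real (Suc (\<rho> n))) \<longlonglongrightarrow> 0"
      using LIMSEQ_subseq_LIMSEQ[OF LIMSEQ_Suc[OF lim_1_over_n] x(2)] by (simp add: o_def)
    have "(\<lambda>n. c n j) \<longlonglongrightarrow> x j" for j
    proof -
      have "(\<lambda>n. c n j - u (\<rho> n) j) \<longlonglongrightarrow> 0"
        by (rule Lim_null_comparison[OF eventually_mono[OF ev] z]) (use c(2) in simp)
      moreover have "(\<lambda>n. u (\<rho> n) j) \<longlonglongrightarrow> x j" using x(3) by (simp add: lim o_def)
      ultimately have "(\<lambda>n. c n j - u (\<rho> n) j + u (\<rho> n) j) \<longlonglongrightarrow> 0 + x j" by (rule tendsto_add)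
      then show ?thesis by simp
    qed
    then have "c \<longlonglongrightarrow> x" by (simp add: lim)
    then have "(\<lambda>n. f (c n)) \<longlonglongrightarrow> f x"
      using cont c(1) x(1) unfolding Q_def[symmetric] continuous_on_sequentially o_def by blast
    then show ?thesis using \<open>c \<longlonglongrightarrow> x\<close> by (simp add: lim)
  qed
  have "f x i = x i" for i
  proof -
    \<comment> \<open>For the finitely many \<open>n\<close> with \<open>\<rho> n \<le> i\<close>
      there is no bracket at coordinate \<open>i\<close>; the limit \<open>x\<close> fills in as a
      dummy point of \<open>Q\<close>.\<close>
    have "\<forall>n. \<exists>a b. a \<in> Q \<and> b \<in> Q \<and> (i < \<rho> n \<longrightarrow> bracket (\<rho> n) (u (\<rho> n)) i a b)"
    proof
      fix n
      show "\<exists>a b. a \<in> Q \<and> b \<in> Q \<and> (i < \<rho> n \<longrightarrow> bracket (\<rho> n) (u (\<rho> n)) i a b)"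
      proof (cases "i < \<rho> n")
        case True
        then obtain a b where ab: "bracket (\<rho> n) (u (\<rho> n)) i a b" using u(2) by blast
        then have "a \<in> Q" "b \<in> Q" by (simp_all add: bracket_def)
        with ab show ?thesis by (intro exI conjI impI)
      next
        case False
        then show ?thesis using x(1) by (intro exI[of _ x]) simp
      qed
    qed
    then obtain a b where ab: "\<And>n. a n \<in> Q" "\<And>n. b n \<in> Q"
        "\<And>n. i < \<rho> n \<Longrightarrow> bracket (\<rho> n) (u (\<rho> n)) i (a n) (b n)"
      by metis
    have ev: "eventually (\<lambda>n. i < \<rho> n) sequentially"
      by (rule eventually_compose_filterlim[OF eventually_gt_at_top filterlim_subseq[OF x(2)]])
    have fa: "(\<lambda>n. f (a n) i) \<longlonglongrightarrow> f x i \<and> (\<lambda>n. a n i) \<longlonglongrightarrow> x i"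
      by (rule flim) (use ab in \<open>auto simp: bracket_def\<close>)
    have fb: "(\<lambda>n. f (b n) i) \<longlonglongrightarrow> f x i \<and> (\<lambda>n. b n i) \<longlonglongrightarrow> x i"
      by (rule flim) (use ab in \<open>auto simp: bracket_def\<close>)
    have "x i \<le> f x i"
      by (rule tendsto_le[OF sequentially_bot conjunct1[OF fa] conjunct2[OF fa] eventually_mono[OF ev]])
        (use ab(3) in \<open>simp add: bracket_def\<close>)
    moreover have "f x i \<le> x i"
      by (rule tendsto_le[OF sequentially_bot conjunct2[OF fb] conjunct1[OF fb] eventually_mono[OF ev]])
        (use ab(3) in \<open>simp add: bracket_def\<close>)
    ultimately show ?thesis by simp
  qed
  then have "f x = x" by (rule ext)
  with x(1) show thesis unfolding Q_def by (rule that)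
qed

subsection \<open>Games in choice form\<close>

text \<open>Compactness is Tychonoff's theorem; metrizability holds because a set of naturals
  indexes a countable product.\<close>

lemma
  assumes "\<And>i. i \<in> J \<Longrightarrow> normed_space_on (E i)"
    and "\<And>i. i \<in> J \<Longrightarrow> compactin (norm_topology (E i)) (X i)"
  shows topspace_profile_topology: "topspace (profile_topology E X J) = (\<Pi>\<^sub>E i\<in>J. X i)"
    and compact_space_profile_topology: "compact_space (profile_topology E X J)"
    and metrizable_space_profile_topology: "metrizable_space (profile_topology E X J)"
proof -
  have "topspace (strategy_topology E X i) = X i" if "i \<in> J" for i
    using compactin_subset_topspace[OF assms(2)[OF that]]
    by (auto simp: strategy_topology_def topspace_subtopology)
  then show "topspace (profile_topology E X J) = (\<Pi>\<^sub>E i\<in>J. X i)"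
    unfolding profile_topology_def topspace_product_topology by (rule PiE_cong)
  have "compact_space (strategy_topology E X i)" if "i \<in> J" for i
    using assms(2)[OF that] by (simp add: strategy_topology_def compact_space_subtopology)
  then show "compact_space (profile_topology E X J)"
    by (simp add: profile_topology_def compact_space_product_topology)
  have "metrizable_space (strategy_topology E X i)" if "i \<in> J" for i
  proof -
    interpret normed_space_on "E i" by (rule assms(1)[OF that])
    show ?thesis
      unfolding strategy_topology_def mtopology_eq_norm_topology[symmetric]
      by (intro metrizable_space_subtopology norm_metric.metrizable_space_mtopology)
  qed
  then show "metrizable_space (profile_topology E X J)"
    by (simp add: profile_topology_def metrizable_space_product_topology)
qed

text \<open>The set is the preimage of \<open>U\<close> under insertion of \<open>y\<close>, which
  is constant in coordinate \<open>i\<close> and a projection in the others.\<close>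

lemma openin_profile_section:
  assumes "openin (profile_topology E X {1..n}) U" "y \<in> topspace (strategy_topology E X i)"
    and "i \<in> {1..n}"
  shows "openin (profile_topology E X (others n i))
    {z \<in> topspace (profile_topology E X (others n i)). z(i := y) \<in> U}"
proof -
  have "continuous_map (profile_topology E X (others n i)) (profile_topology E X {1..n}) (\<lambda>z. z(i := y))"
    unfolding profile_topology_def continuous_map_componentwise
  proof (intro conjI ballI)
    show "(\<lambda>z. z(i := y)) ` topspace (product_topology (strategy_topology E X) (others n i)) \<subseteq> extensional {1..n}"
      using assms(3) by (auto simp: others_def PiE_def extensional_def)
    fix j assume "j \<in> {1..n}"
    then show "continuous_map (product_topology (strategy_topology E X) (others n i))
        (strategy_topology E X j) (\<lambda>z. (z(i := y)) j)"
      using assms(2) by (cases "j = i") (auto simp: others_def intro!: continuous_map_product_projection)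
  qed
  then show ?thesis using openin_continuous_map_preimage assms(1) by blast
qed

lemma continuous_map_restrict_profile:
  assumes "I \<subseteq> J"
  shows "continuous_map (profile_topology E X J) (profile_topology E X I) (\<lambda>x. restrict x I)"
  unfolding profile_topology_def continuous_map_componentwise
  using assms by (auto intro!: continuous_map_product_projection)

theorem theorem3:
  fixes n :: nat
    and E :: "nat \<Rightarrow> 'e nspace"
    and X :: "nat \<Rightarrow> 'e set"
    and C :: "nat \<Rightarrow> (nat \<Rightarrow> 'e) set"
  assumes game: "game_in_choice_form n X C"
    and some_choice: "\<And>x. x \<in> (\<Pi>\<^sub>E i\<in>{1..n}. X i) \<Longrightarrow>
      \<exists>i\<in>{1..n}. upper_section X C i (restrict x (others n i)) \<noteq> {}"
    and banach: "\<And>i. i \<in> {1..n} \<Longrightarrow> banach_space_on (E i)"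
    and a: "\<And>i. i \<in> {1..n} \<Longrightarrow>
      X i \<noteq> {} \<and> convex_in (E i) (X i) \<and> compactin (norm_topology (E i)) (X i)"
    and b: "\<And>i. i \<in> {1..n} \<Longrightarrow> C i \<noteq> {} \<and> openin (profile_topology E X {1..n}) (C i)"
    and c: "\<And>i. i \<in> {1..n} \<Longrightarrow> choice_domain n X C i \<noteq> {} \<and>
      openin (profile_topology E X (others n i)) (choice_domain n X C i)"
    and d: "\<And>i. i \<in> {1..n} \<Longrightarrow> \<exists>S :: (nat \<Rightarrow> 'e) \<Rightarrow> 'e set.
      lower_semicontinuous_map
        (subtopology (profile_topology E X (others n i)) (choice_domain n X C i))
        (strategy_topology E X i) S \<and>
      (\<forall>z\<in>choice_domain n X C i.
        closedin (strategy_topology E X i) (S z) \<and> convex_in (E i) (S z) \<and>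
        upper_section X C i z \<inter> S z \<noteq> {})"
    and e: "\<And>i z. i \<in> {1..n} \<Longrightarrow> z \<in> (\<Pi>\<^sub>E j\<in>others n i. X j) \<Longrightarrow>
      convex_in (E i) (upper_section X C i z) \<or> upper_section X C i z = {}"
  shows "\<exists>x. equilibrium_in_choice n X C x"
proof -

  \<comment> \<open>Topology of the profile spaces and their projections\<close>
  define P where "P = profile_topology E X {1..n}"
  define R where "R i x = restrict x (others n i)" for i and x :: "nat \<Rightarrow> 'e"
  define Oth where "Oth i = profile_topology E X (others n i)" for i
  have norm: "normed_space_on (E i)" if "i \<in> {1..n}" for i
    using banach[OF that] by (simp add: banach_space_on_def)
  have sub: "others n i \<subseteq> {1..n}" for i by (auto simp: others_def)
  have cpt: "compactin (norm_topology (E i)) (X i)" and cvx: "convex_in (E i) (X i)"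
    and XE: "X i \<subseteq> carrier (E i)" if "i \<in> {1..n}" for i
    using a[OF that] by (auto simp: convex_in_def)
  have topP: "topspace P = (\<Pi>\<^sub>E i\<in>{1..n}. X i)" and cP: "compact_space P"
    unfolding P_def
    by (rule topspace_profile_topology compact_space_profile_topology, fact norm, fact cpt)+
  have topO: "topspace (Oth i) = (\<Pi>\<^sub>E j\<in>others n i. X j)" and cO: "compact_space (Oth i)"
    and mO: "metrizable_space (Oth i)" for i
    unfolding Oth_def
    by (rule topspace_profile_topology compact_space_profile_topology metrizable_space_profile_topology,
        erule norm[OF subsetD[OF sub]], erule cpt[OF subsetD[OF sub]])+
  have topX: "topspace (strategy_topology E X i) = X i" if "i \<in> {1..n}" for i
    using XE[OF that] normed_space_on.topspace_norm_topology[OF norm[OF that]]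
    by (auto simp: strategy_topology_def)
  have contR: "continuous_map P (Oth i) (R i)" for i
    unfolding P_def Oth_def R_def using continuous_map_restrict_profile[OF sub] .
  have contx: "continuous_map P (norm_topology (E i)) (\<lambda>x. x i)" if "i \<in> {1..n}" for i
  proof -
    have "continuous_map P (strategy_topology E X i) (\<lambda>x. x i)"
      unfolding P_def profile_topology_def using that by (rule continuous_map_product_projection)
    then show ?thesis by (simp add: strategy_topology_def continuous_map_in_subtopology)
  qed

  \<comment> \<open>Plateau functions for the choices of each player\<close>
  define plateau where "plateau i y \<phi> V \<longleftrightarrow>
      (\<forall>k. continuous_map (Oth i) (top_of_set {0..1::real}) (\<phi> k)) \<and>
      (\<forall>k. \<forall>z\<in>topspace (Oth i). \<phi> k z \<noteq> 0 \<longrightarrow> y k \<in> upper_section X C i z) \<and>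
      (\<forall>k. openin (Oth i) (V k)) \<and> (\<forall>k. \<forall>z\<in>V k. \<phi> k z = 1) \<and>
      choice_domain n X C i \<subseteq> (\<Union>k. V k) \<and> (\<forall>k. V k \<noteq> {})"
    for i and y :: "nat \<Rightarrow> 'e" and \<phi> and V :: "nat \<Rightarrow> (nat \<Rightarrow> 'e) set"
  have "\<exists>y \<phi> V. plateau i y \<phi> V" if i: "i \<in> {1..n}" for i
  proof -
    \<comment> \<open>Openness of \<open>C i\<close> in the full product makes every fixed choice
      \<open>y\<close> remain valid for nearby profiles of the others.\<close>
    have wit: "\<exists>y. y \<in> upper_section X C i z \<and> openin (Oth i) {w \<in> topspace (Oth i). y \<in> upper_section X C i w}"
      if z: "z \<in> choice_domain n X C i" for z
    proof -
      obtain y where y: "y \<in> upper_section X C i z" using z by (auto simp: choice_domain_def)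
      then have "y \<in> X i" by (simp add: upper_section_def)
      then have "openin (Oth i) {w \<in> topspace (Oth i). w(i := y) \<in> C i}"
        unfolding Oth_def using b[OF i] topX[OF i] i by (intro openin_profile_section) auto
      moreover have "{w \<in> topspace (Oth i). w(i := y) \<in> C i} = {w \<in> topspace (Oth i). y \<in> upper_section X C i w}"
        using \<open>y \<in> X i\<close> by (auto simp: upper_section_def)
      ultimately show ?thesis using y by auto
    qed
    have W: "openin (Oth i) (choice_domain n X C i)" "choice_domain n X C i \<noteq> {}"
      using c[OF i] by (simp_all add: Oth_def)
    show ?thesis
    proof (rule countable_plateau_functions[OF cO mO W wit])
      fix y :: "nat \<Rightarrow> 'e" and \<phi> :: "nat \<Rightarrow> (nat \<Rightarrow> 'e) \<Rightarrow> real"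
        and V :: "nat \<Rightarrow> (nat \<Rightarrow> 'e) set"
      assume "\<And>k. continuous_map (Oth i) (top_of_set {0..1}) (\<phi> k)"
        "\<And>k z. z \<in> topspace (Oth i) \<Longrightarrow> \<phi> k z \<noteq> 0 \<Longrightarrow> y k \<in> upper_section X C i z"
        "\<And>k. openin (Oth i) (V k)" "\<And>k z. z \<in> V k \<Longrightarrow> \<phi> k z = 1"
        "choice_domain n X C i \<subseteq> (\<Union>k. V k)" "\<And>k. V k \<noteq> {}"
      then have "plateau i y \<phi> V" by (simp add: plateau_def)
      then show ?thesis by (intro exI)
    qed
  qed
  then obtain y \<phi> V where pl: "\<And>i. i \<in> {1..n} \<Longrightarrow> plateau i (y i) (\<phi> i) (V i)"
    by metis
  have \<phi>: "continuous_map (Oth i) (top_of_set {0..1}) (\<phi> i k)"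
    and supp: "z \<in> topspace (Oth i) \<Longrightarrow> \<phi> i k z \<noteq> 0 \<Longrightarrow> y i k \<in> upper_section X C i z"
    and V: "openin (Oth i) (V i k)" "V i k \<noteq> {}" and V1: "z \<in> V i k \<Longrightarrow> \<phi> i k z = 1"
    and cover: "choice_domain n X C i \<subseteq> (\<Union>k. V i k)" if "i \<in> {1..n}" for i k z
    using pl[OF that] by (simp_all add: plateau_def)
  have \<phi>01: "\<phi> i k z \<in> {0..1}" if "i \<in> {1..n}" "z \<in> topspace (Oth i)" for i k z
    using continuous_map_image_subset_topspace[OF \<phi>[OF that(1), of k]] that(2) by auto
  \<comment> \<open>At a point of the nonempty set \<open>V i k\<close> the plateau function is
    \<open>1\<close>, which puts \<open>y i k\<close> in a section and so in
    \<open>X i\<close>.\<close>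
  have yX: "y i k \<in> X i" if i: "i \<in> {1..n}" for i k
  proof -
    obtain z where z: "z \<in> V i k" using V(2)[OF i] by blast
    have "y i k \<in> upper_section X C i z"
      using supp[OF i subsetD[OF openin_subset[OF V(1)[OF i]] z]] V1[OF i z] by simp
    then show ?thesis by (simp add: upper_section_def)
  qed
  then have yE: "y i k \<in> carrier (E i)" if "i \<in> {1..n}" for i k
    using XE that by blast

  \<comment> \<open>Cut-off blends and the closed sets where they are played\<close>
  define g where "g i m x = normed_space_on.blend (E i) m (\<lambda>j. \<phi> i j (R i x)) (y i) (y i 0)" for i m x
  have contg: "continuous_map P (norm_topology (E i)) (g i m)" if i: "i \<in> {1..n}" for i m
    unfolding g_def
    by (rule normed_space_on.continuous_map_blend[OF norm[OF i]])
      (use yE[OF i] continuous_map_compose[OF contR \<phi>[OF i]] in \<open>auto simp: o_def\<close>)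

  \<comment> \<open>On \<open>V i k\<close> term \<open>k\<close> takes the whole remaining share,
    so the blend of \<open>Suc k\<close> terms is already final. This makes the condition
    independent of the cut-off \<open>m\<close>.\<close>
  define D where "D i k = {x \<in> topspace P. R i x \<in> V i k \<longrightarrow> x i = g i (Suc k) x}" for i k
  \<comment> \<open>The implication is a union of two closed sets: the complement of the open
    preimage of \<open>V i k\<close>, and the set where two continuous maps into a Hausdorff space
    agree.\<close>
  have D: "closedin P (D i k)" if i: "i \<in> {1..n}" for i k
  proof -
    interpret normed_space_on "E i" by (rule norm[OF i])
    have "Hausdorff_space (norm_topology (E i))"
      unfolding mtopology_eq_norm_topology[symmetric] by (rule norm_metric.Hausdorff_space_mtopology)
    then have "closedin P {x \<in> topspace P. x i = g i (Suc k) x}"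
      using contx[OF i] contg[OF i] by (intro closedin_continuous_maps_eq)
    moreover have "closedin P (topspace P - {x \<in> topspace P. R i x \<in> V i k})"
      by (intro closedin_diff closedin_topspace openin_continuous_map_preimage[OF contR] V(1)[OF i])
    ultimately have "closedin P ((topspace P - {x \<in> topspace P. R i x \<in> V i k}) \<union>
        {x \<in> topspace P. x i = g i (Suc k) x})"
      by (rule closedin_Un[rotated])
    also have "\<dots> = D i k" by (auto simp: D_def)
    finally show ?thesis .
  qed
  \<comment> \<open>Inserting \<open>topspace P\<close> keeps the intersection inside the space when
    \<open>m = 0\<close>.\<close>
  define A where "A m = \<Inter> (insert (topspace P) ((\<lambda>(i, k). D i k) ` ({1..n} \<times> {..<m})))" for m
  have "\<Inter> (range A) \<noteq> {}"
  proof (rule compact_space_imp_nest[OF cP])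
    show "closedin P (A m)" for m
      unfolding A_def using D by (intro closedin_Inter) auto
    show "decseq A"
      unfolding decseq_def A_def by (intro allI impI Inter_anti_mono insert_mono image_mono) auto

    \<comment> \<open>Nonemptiness from a fixed point of the weights\<close>
    show "A m \<noteq> {}" for m
    proof -
      let ?Q = "PiE UNIV (\<lambda>_::nat. {0..1::real})"
      \<comment> \<open>The cube point \<open>\<sigma>\<close> holds the weights of all players at
        once, with term \<open>j\<close> of player \<open>i\<close> at
        \<open>prod_encode (i, j)\<close>; \<open>x\<close> turns free weights into a
        profile.\<close>
      define x where "x \<sigma> = (\<lambda>i\<in>{1..n}. normed_space_on.blend (E i) m
          (\<lambda>j. \<sigma> (prod_encode (i, j))) (y i) (y i 0))" for \<sigma> :: "nat \<Rightarrow> real"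
      have \<sigma>cont: "continuous_map (top_of_set ?Q) (top_of_set {0..1}) (\<lambda>\<sigma>. \<sigma> l)" for l
        by (auto simp: continuous_map_in_subtopology continuous_on_subset[OF continuous_on_product_coordinates])
      have xX: "x \<sigma> i \<in> X i" if "\<sigma> \<in> ?Q" "i \<in> {1..n}" for \<sigma> i
        using that unfolding x_def
        by (auto intro!: normed_space_on.blend_in_convex[OF norm cvx] yX)
      have x: "continuous_map (top_of_set ?Q) P x"
        unfolding P_def profile_topology_def continuous_map_componentwise
      proof (intro conjI ballI)
        show "x ` topspace (top_of_set ?Q) \<subseteq> extensional {1..n}" by (auto simp: x_def)
        fix i assume i: "i \<in> {1..n}"
        have "continuous_map (top_of_set ?Q) (norm_topology (E i))
            (\<lambda>\<sigma>. normed_space_on.blend (E i) m (\<lambda>j. \<sigma> (prod_encode (i, j))) (y i) (y i 0))"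
          by (rule normed_space_on.continuous_map_blend[OF norm[OF i] \<sigma>cont]) (use yE[OF i] in auto)
        then have "continuous_map (top_of_set ?Q) (norm_topology (E i)) (\<lambda>\<sigma>. x \<sigma> i)"
          using i by (simp add: x_def)
        then show "continuous_map (top_of_set ?Q) (strategy_topology E X i) (\<lambda>\<sigma>. x \<sigma> i)"
          unfolding strategy_topology_def continuous_map_in_subtopology using xX i by auto
      qed
      \<comment> \<open>The weights are read off again from the resulting profile. Codes that belong
        to no player get the value \<open>0\<close>.\<close>
      define F where "F \<sigma> l = (case prod_decode l of (i, j) \<Rightarrow>
          if i \<in> {1..n} then \<phi> i j (R i (x \<sigma>)) else 0)" for \<sigma> l
      have F1: "continuous_map (top_of_set ?Q) (top_of_set {0..1}) (\<lambda>\<sigma>. F \<sigma> l)" for l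
      proof (cases "prod_decode l")
        case (Pair i j)
        show ?thesis
        proof (cases "i \<in> {1..n}")
          case True
          then show ?thesis
            using continuous_map_compose[OF continuous_map_compose[OF x contR] \<phi>[OF True]]
            by (simp add: F_def Pair o_def)
        next
          case False
          then have "(\<lambda>\<sigma>. F \<sigma> l) = (\<lambda>_. 0)" by (auto simp: F_def Pair)
          then show ?thesis by simp
        qed
      qed
      have "continuous_on ?Q F"
        by (rule continuous_on_coordinatewise_then_product)
          (use F1 in \<open>simp add: continuous_map_in_subtopology\<close>)
      moreover have "F \<in> ?Q \<rightarrow> ?Q"
        using continuous_map_image_subset_topspace[OF F1] by (auto simp: image_subset_iff)
      ultimately obtain \<sigma> where \<sigma>: "\<sigma> \<in> ?Q" "F \<sigma> = \<sigma>"
        by (rule brouwer_Hilbert_cube)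
      have xP: "x \<sigma> \<in> topspace P"
        using continuous_map_image_subset_topspace[OF x] \<sigma>(1) by auto
      \<comment> \<open>At the fixed point the weights that build the profile are the plateau values
        at that profile, so every player plays the blend with cut-off \<open>m\<close>.\<close>
      have "x \<sigma> i = g i m (x \<sigma>)" if "i \<in> {1..n}" for i
      proof -
        have "\<sigma> (prod_encode (i, j)) = \<phi> i j (R i (x \<sigma>))" for j
          using fun_cong[OF \<sigma>(2), of "prod_encode (i, j)"] that by (simp add: F_def)
        then show ?thesis using that by (simp add: x_def g_def)
      qed
      moreover have "g i m (x \<sigma>) = g i (Suc k) (x \<sigma>)"
        if "i \<in> {1..n}" "k < m" "R i (x \<sigma>) \<in> V i k" for i k
        unfolding g_def
        by (rule normed_space_on.blend_truncate[OF norm]) (use that yE V1 in auto)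
      ultimately have "x \<sigma> \<in> A m" using xP by (auto simp: A_def D_def)
      then show ?thesis by blast
    qed
  qed

  \<comment> \<open>A common point is an equilibrium\<close>
  then obtain x where xA: "\<And>m. x \<in> A m" by blast
  then have xP: "x \<in> topspace P" by (auto simp: A_def)
  have "x i \<in> upper_section X C i (R i x)"
    if i: "i \<in> {1..n}" and ne: "upper_section X C i (R i x) \<noteq> {}" for i
  proof -
    have RO: "R i x \<in> topspace (Oth i)"
      using continuous_map_image_subset_topspace[OF contR] xP by blast
    then have "R i x \<in> choice_domain n X C i" using ne topO by (simp add: choice_domain_def)
    then obtain k where k: "R i x \<in> V i k" using cover[OF i] by blast
    \<comment> \<open>The indices in \<open>A m\<close> stop below \<open>m\<close>, so
      \<open>D i k\<close> first enters at \<open>Suc k\<close>.\<close>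
    have "x \<in> D i k" using xA[of "Suc k"] i by (auto simp: A_def)
    then have "x i = g i (Suc k) x" using k by (simp add: D_def)
    also have "\<dots> \<in> upper_section X C i (R i x)"
      unfolding g_def
    \<comment> \<open>Here \<open>K\<close> is the section at \<open>R i x\<close>: a nonzero
      plateau value puts \<open>y i j\<close> in it, and the value at \<open>k\<close> is
      \<open>1\<close>.\<close>
    proof (rule normed_space_on.blend_in_support[OF norm[OF i]])
      show "convex_in (E i) (upper_section X C i (R i x))"
        using e[OF i] RO ne topO by blast
    qed (use i RO k yE \<phi>01 supp V1 in auto)
    finally show ?thesis .
  qed
  then have "equilibrium_in_choice n X C x"
    using xP topP by (simp add: equilibrium_in_choice_def R_def)
  then show ?thesis by (rule exI[of _ x])
qed

end
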